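(* Let $X_1,X_2,\ldots$ be independent and identically distributed standard exponential random variables. For any positive integer $k\le 4$ and any $n\in\mathbb{N}$, the function $$(x_1,\ldots,x_n)\mapsto \mathbb{E}\Big(\sum_{j=1}^n\sqrt{x_j}\,X_j\Big)^k$$ is Schur-concave on $\mathbb{R}^n_+$.
   Context: A standard exponential random variable has density $e^{-x}\mathbf 1_{x>0}$. $\mathbb{R}^n_+$ is the set of vectors in $\mathbb{R}^n$ with non-negative coordinates. For $x\in\mathbb{R}^n$ let $x_1^*\ge\cdots\ge x_n^*$ be its decreasing rearrangement. One says that $x$ is majorized by $y$, written $x\prec y$, if $\sum_{i=1}^n x_i=\sum_{i=1}^n y_i$ and $\sum_{i=1}^k x_i^*\le\sum_{i=1}^k y_i^*$ for all $k=1,\ldots,n$. A function $f$ is Schur-concave if $x\prec y$ implies $f(x)\ge f(y)$ (for $x,y$ in its domain). *)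

theory Defs
  imports "HOL-Probability.Probability"
begin

text \<open>Vectors in $\mathbb{R}^n$ are real lists of length \<open>n\<close>, the coordinates being
  \<open>x ! 0, \<dots>, x ! (n - 1)\<close>.\<close>

definition nonneg_orthant :: "nat \<Rightarrow> real list set" where
  "nonneg_orthant n = {x. length x = n \<and> (\<forall>i<n. 0 \<le> x ! i)}"

definition decreasing_rearrangement :: "real list \<Rightarrow> real list" where
  "decreasing_rearrangement x = rev (sort x)"

definition majorized :: "real list \<Rightarrow> real list \<Rightarrow> bool" (infix "\<prec>" 50) where
  "x \<prec> y \<longleftrightarrow>
     length x = length y \<and>
     (\<Sum>i<length x. x ! i) = (\<Sum>i<length y. y ! i) \<and>
     (\<forall>k\<in>{1..length x}. (\<Sum>i<k. decreasing_rearrangement x ! i)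
                       \<le> (\<Sum>i<k. decreasing_rearrangement y ! i))"

definition schur_concave_on :: "real list set \<Rightarrow> (real list \<Rightarrow> real) \<Rightarrow> bool" where
  "schur_concave_on S f \<longleftrightarrow> (\<forall>x\<in>S. \<forall>y\<in>S. x \<prec> y \<longrightarrow> f x \<ge> f y)"

end

theory Submission
  imports Defs "HOL-Computational_Algebra.Formal_Power_Series"
begin

text \<open>
  Since \<open>E X\<^sub>j\<^sup>k = k!\<close>, independence gives the exponential moment generating function of
  \<open>S = \<Sum>\<^sub>j a\<^sub>j X\<^sub>j\<close> as the formal power series \<open>\<Prod>\<^sub>j 1 / (1 - a\<^sub>j t)\<close>; thus \<open>E S\<^sup>k\<close> is \<open>k!\<close> times
  the complete homogeneous symmetric polynomial \<open>h\<^sub>k(a\<^sub>1, \<dots>, a\<^sub>n)\<close>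
  (\<open>expectation_power_weighted_sum\<close>). Put \<open>a\<^sub>j = \<surd>x\<^sub>j\<close>.

  A majorized vector arises from the majorizing one by finitely many transfers, each moving two
  coordinates towards each other at constant sum (\<open>transfer_monotone_majorization\<close>), together with
  a permutation of the coordinates, which changes nothing by symmetry. So only two coordinates
  \<open>a, b\<close> change at a time, and a transfer keeps \<open>r = a\<^sup>2 + b\<^sup>2\<close> fixed while it increases
  \<open>P = a b\<close>. In terms of \<open>r\<close> and \<open>P\<close> one has \<open>h\<^sub>1(a,b) = \<surd>(r + 2 P)\<close>, \<open>h\<^sub>2(a,b) = r + P\<close>,
  \<open>h\<^sub>3(a,b) = r \<surd>(r + 2 P)\<close> and \<open>h\<^sub>4(a,b) = r\<^sup>2 + r P - P\<^sup>2\<close>. All of these increase with \<open>P\<close>, the last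
  one because \<open>2 P \<le> r\<close>. The product of the remaining factors \<open>1 / (1 - a\<^sub>j t)\<close> has nonnegative
  coefficients, so the monotonicity passes from two variables to all of them.
\<close>

section \<open>Moments of weighted sums of exponential variables\<close>

definition geometric_fps :: "real \<Rightarrow> real fps" where
  "geometric_fps a = Abs_fps (\<lambda>i. a ^ i)"

lemma geometric_fps_nth [simp]: "fps_nth (geometric_fps a) i = a ^ i"
  by (simp add: geometric_fps_def)

text \<open>Adding one more variable expands the power by the binomial theorem; the factorials of the
  moments cancel the binomial coefficients, and what is left is the Cauchy product.\<close>

lemma (in prob_space) expectation_power_weighted_sum:
  fixes X :: "'i \<Rightarrow> 'a \<Rightarrow> real" and a :: "'i \<Rightarrow> real"
  assumes "finite A"
    and "indep_vars (\<lambda>_. borel) X A"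
    and "\<And>j. j \<in> A \<Longrightarrow> distributed M lborel (X j) (exponential_density 1)"
  shows "integrable M (\<lambda>\<omega>. (\<Sum>j\<in>A. a j * X j \<omega>) ^ k)
    \<and> expectation (\<lambda>\<omega>. (\<Sum>j\<in>A. a j * X j \<omega>) ^ k)
        = fact k * fps_nth (\<Prod>j\<in>A. geometric_fps (a j)) k"
  using assms
proof (induction A arbitrary: k rule: finite_induct)
  case empty
  then show ?case by (cases k) (auto simp: prob_space)
next
  case (insert j A)
  define S where "S = (\<lambda>\<omega>. \<Sum>i\<in>A. a i * X i \<omega>)"
  define Y where "Y = (\<lambda>\<omega>. a j * X j \<omega>)"
  define p where "p = (\<Prod>i\<in>A. geometric_fps (a i))"
  have "indep_vars (\<lambda>_. borel) X A"
    using insert.prems(1) by (rule indep_vars_subset) auto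
  then have S: "integrable M (\<lambda>\<omega>. S \<omega> ^ m)" "expectation (\<lambda>\<omega>. S \<omega> ^ m) = fact m * fps_nth p m" for m
    using insert.IH[of m] insert.prems(2) by (auto simp: S_def p_def)
  have X: "has_bochner_integral M (\<lambda>\<omega>. X j \<omega> ^ m) (fact m)" for m
    using has_bochner_integral_erlang_ith_moment[of 1 "X j" 0 m] insert.prems(2)[of j] by simp
  have Y: "integrable M (\<lambda>\<omega>. Y \<omega> ^ m)" "expectation (\<lambda>\<omega>. Y \<omega> ^ m) = a j ^ m * fact m" for m
    using X[of m] by (auto simp: Y_def power_mult_distrib has_bochner_integral_iff)
  have "indep_vars (\<lambda>_. borel) (\<lambda>i \<omega>. a i * X i \<omega>) (insert j A)"
    using insert.prems(1) by (rule indep_vars_compose2) simp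
  then have "indep_var borel Y borel S"
    unfolding Y_def S_def by (rule indep_vars_sum[OF insert.hyps])
  then have "indep_var borel ((\<lambda>x. x ^ l) \<circ> Y) borel ((\<lambda>x. x ^ m) \<circ> S)" for l m
    by (rule indep_var_compose) auto
  then have ind: "indep_var borel (\<lambda>\<omega>. Y \<omega> ^ l) borel (\<lambda>\<omega>. S \<omega> ^ m)" for l m
    by (simp add: comp_def)
  have int: "integrable M (\<lambda>\<omega>. Y \<omega> ^ l * S \<omega> ^ m)" for l m
    by (rule indep_var_integrable[OF ind Y(1) S(1)])
  have expe: "expectation (\<lambda>\<omega>. Y \<omega> ^ l * S \<omega> ^ m) = a j ^ l * fact l * (fact m * fps_nth p m)" for l m
    using indep_var_lebesgue_integral[OF ind Y(1) S(1)] by (simp add: S(2) Y(2))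
  have binom: "(\<Sum>i\<in>insert j A. a i * X i \<omega>) ^ k
      = (\<Sum>l\<le>k. real (k choose l) * (Y \<omega> ^ l * S \<omega> ^ (k - l)))" for \<omega>
  proof -
    have "(\<Sum>i\<in>insert j A. a i * X i \<omega>) = Y \<omega> + S \<omega>"
      using insert.hyps by (simp add: S_def Y_def)
    then show ?thesis by (simp add: binomial_ring mult.assoc)
  qed
  have "expectation (\<lambda>\<omega>. (\<Sum>i\<in>insert j A. a i * X i \<omega>) ^ k)
      = (\<Sum>l\<le>k. real (k choose l) * (a j ^ l * fact l * (fact (k - l) * fps_nth p (k - l))))"
    unfolding binom by (simp add: int expe)
  also have "\<dots> = (\<Sum>l\<le>k. fact k * (a j ^ l * fps_nth p (k - l)))"
    by (intro sum.cong) (auto simp: binomial_fact)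
  also have "\<dots> = fact k * fps_nth (geometric_fps (a j) * p) k"
    by (simp add: fps_mult_nth sum_distrib_left atMost_atLeast0)
  finally show ?case
    unfolding binom using insert.hyps by (simp add: p_def int)
qed

lemma fps_nth_prod_nonneg:
  fixes f :: "'i \<Rightarrow> real fps"
  assumes "\<And>j i. j \<in> A \<Longrightarrow> 0 \<le> fps_nth (f j) i"
  shows "0 \<le> fps_nth (\<Prod>j\<in>A. f j) k"
  using assms
  by (induction A arbitrary: k rule: infinite_finite_induct)
    (auto simp: fps_mult_nth intro!: sum_nonneg mult_nonneg_nonneg)

section \<open>The effect of a transfer between two coordinates\<close>

text \<open>The formulas \<open>h\<close> below express the coefficients through \<open>r = a\<^sup>2 + b\<^sup>2\<close>, \<open>P = a b\<close> and
  \<open>a + b = \<surd>(r + 2 P)\<close>. The degree bound is essential: \<open>h\<^sub>5(a,b) = (a + b) (r\<^sup>2 - P\<^sup>2)\<close> decreases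
  with \<open>P\<close> when \<open>2 P\<close> is close to \<open>r\<close>, that is, near \<open>a = b\<close>.\<close>

lemma geometric_fps_pair_mono:
  fixes a b c d :: real
  assumes nonneg: "0 \<le> a" "0 \<le> b" "0 \<le> c" "0 \<le> d"
    and squares: "a\<^sup>2 + b\<^sup>2 = c\<^sup>2 + d\<^sup>2"
    and prod: "a * b \<le> c * d"
    and "m \<le> 4"
  shows "fps_nth (geometric_fps a * geometric_fps b) m \<le> fps_nth (geometric_fps c * geometric_fps d) m"
proof -
  have "(a + b)\<^sup>2 \<le> (c + d)\<^sup>2"
    using squares prod by (simp add: power2_sum)
  then have lin: "a + b \<le> c + d"
    by (rule power2_le_imp_le) (use nonneg in simp)
  have cubic: "(a + b) * (a\<^sup>2 + b\<^sup>2) \<le> (c + d) * (c\<^sup>2 + d\<^sup>2)"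
    unfolding squares by (intro mult_right_mono lin) simp
  have "2 * (a * b) \<le> a\<^sup>2 + b\<^sup>2" "2 * (c * d) \<le> a\<^sup>2 + b\<^sup>2"
    using sum_squares_bound[of a b] sum_squares_bound[of c d] squares by auto
  then have "0 \<le> (c * d - a * b) * ((a\<^sup>2 + b\<^sup>2) - a * b - c * d)"
    using prod by (intro mult_nonneg_nonneg) auto
  then have "(a\<^sup>2 + b\<^sup>2)\<^sup>2 + (a\<^sup>2 + b\<^sup>2) * (a * b) - (a * b)\<^sup>2
      \<le> (a\<^sup>2 + b\<^sup>2)\<^sup>2 + (a\<^sup>2 + b\<^sup>2) * (c * d) - (c * d)\<^sup>2"
    by (simp add: algebra_simps power2_eq_square)
  then have quartic: "(a\<^sup>2 + b\<^sup>2)\<^sup>2 + (a\<^sup>2 + b\<^sup>2) * (a * b) - (a * b)\<^sup>2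
      \<le> (c\<^sup>2 + d\<^sup>2)\<^sup>2 + (c\<^sup>2 + d\<^sup>2) * (c * d) - (c * d)\<^sup>2"
    unfolding squares .
  have h: "fps_nth (geometric_fps u * geometric_fps v) 1 = u + v"
    "fps_nth (geometric_fps u * geometric_fps v) 2 = (u\<^sup>2 + v\<^sup>2) + u * v"
    "fps_nth (geometric_fps u * geometric_fps v) 3 = (u + v) * (u\<^sup>2 + v\<^sup>2)"
    "fps_nth (geometric_fps u * geometric_fps v) 4
       = (u\<^sup>2 + v\<^sup>2)\<^sup>2 + (u\<^sup>2 + v\<^sup>2) * (u * v) - (u * v)\<^sup>2" for u v
    by (simp_all add: fps_mult_nth numeral_eq_Suc algebra_simps)
  consider "m = 0" | "m = 1" | "m = 2" | "m = 3" | "m = 4"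
    using \<open>m \<le> 4\<close> by linarith
  then show ?thesis
  proof cases
    case 1
    then show ?thesis by simp
  next
    case 2
    then show ?thesis using lin by (simp only: h)
  next
    case 3
    then show ?thesis using squares prod by (simp only: h)
  next
    case 4
    then show ?thesis using cubic by (simp only: h)
  next
    case 5
    then show ?thesis using quartic by (simp only: h)
  qed
qed

lemma complete_homogeneous_sqrt_transfer:
  fixes y :: "nat \<Rightarrow> real"
  assumes "i < n" "j < n" "i \<noteq> j"
    and y: "\<And>l. l < n \<Longrightarrow> 0 \<le> y l"
    and d: "0 \<le> d" "y j + d \<le> y i - d"
    and "k \<le> 4"
  shows "fps_nth (\<Prod>l<n. geometric_fps (sqrt (y l))) k
    \<le> fps_nth (\<Prod>l<n. geometric_fps (sqrt ((y(i := y i - d, j := y j + d)) l))) k"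
    (is "_ \<le> fps_nth (\<Prod>l<n. geometric_fps (sqrt (?z l))) k")
proof -
  let ?R = "{..<n} - {i, j}"
  let ?p = "\<Prod>l\<in>?R. geometric_fps (sqrt (y l))"
  have set: "{..<n} = insert i (insert j ?R)"
    using assms by auto
  have split: "(\<Prod>l<n. f l) = f i * f j * (\<Prod>l\<in>?R. f l)" for f :: "nat \<Rightarrow> real fps"
    by (subst set) (use \<open>i \<noteq> j\<close> in \<open>simp add: mult.assoc\<close>)
  have rest: "(\<Prod>l\<in>?R. geometric_fps (sqrt (?z l))) = ?p"
    by (intro prod.cong) auto
  have nn: "0 \<le> y i" "0 \<le> y j"
    using assms by auto
  have "0 \<le> d * (y i - d - y j)"
    using d by (intro mult_nonneg_nonneg) auto
  then have "y i * y j \<le> (y i - d) * (y j + d)"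
    by (simp add: algebra_simps)
  then have "sqrt (y i) * sqrt (y j) \<le> sqrt (y i - d) * sqrt (y j + d)"
    by (simp add: real_sqrt_mult[symmetric])
  then have "fps_nth (geometric_fps (sqrt (y i)) * geometric_fps (sqrt (y j))) m
      \<le> fps_nth (geometric_fps (sqrt (y i - d)) * geometric_fps (sqrt (y j + d))) m" if "m \<le> 4" for m
    using nn d that by (intro geometric_fps_pair_mono) auto
  moreover have "0 \<le> fps_nth ?p m" for m
    using y by (intro fps_nth_prod_nonneg) auto
  ultimately have "fps_nth (geometric_fps (sqrt (y i)) * geometric_fps (sqrt (y j)) * ?p) k
      \<le> fps_nth (geometric_fps (sqrt (y i - d)) * geometric_fps (sqrt (y j + d)) * ?p) k"
    unfolding fps_mult_nth[of _ ?p] using \<open>k \<le> 4\<close> by (intro sum_mono mult_right_mono) auto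
  then show ?thesis
    unfolding split rest using \<open>i \<noteq> j\<close> by simp
qed

section \<open>Majorization by successive transfers\<close>

text \<open>This is the classical reduction of Hardy, Littlewood and Polya. Let \<open>k\<close> be the first index
  with \<open>y k < x k\<close>. The partial sums force an earlier \<open>j\<close> with \<open>x j < y j\<close>, and as \<open>x\<close> is decreasing,
  \<open>y k < x k \<le> x j < y j\<close>. Moving from \<open>j\<close> to \<open>k\<close> the largest amount that overshoots neither
  target makes \<open>y\<close> agree with \<open>x\<close> in at least one more coordinate. The partial sums still dominate, because \<open>x \<le> y\<close> holds at every index before \<open>k\<close>.\<close>

lemma transfer_monotone_majorization:
  fixes x y :: "nat \<Rightarrow> real" and F :: "(nat \<Rightarrow> real) \<Rightarrow> real"
  assumes step: "\<And>y i j d. i < n \<Longrightarrow> j < n \<Longrightarrow> i \<noteq> j \<Longrightarrow> (\<And>l. l < n \<Longrightarrow> 0 \<le> y l) \<Longrightarrow> 0 \<le> d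
      \<Longrightarrow> y j + d \<le> y i - d \<Longrightarrow> F y \<le> F (y(i := y i - d, j := y j + d))"
    and cong: "\<And>y z. (\<And>i. i < n \<Longrightarrow> y i = z i) \<Longrightarrow> F y = F z"
    and x: "\<And>i. i < n \<Longrightarrow> 0 \<le> x i"
    and decreasing: "\<And>i j. i \<le> j \<Longrightarrow> j < n \<Longrightarrow> x j \<le> x i"
    and "\<And>i. i < n \<Longrightarrow> 0 \<le> y i"
    and "\<And>m. m \<le> n \<Longrightarrow> (\<Sum>i<m. x i) \<le> (\<Sum>i<m. y i)"
    and "(\<Sum>i<n. x i) = (\<Sum>i<n. y i)"
  shows "F y \<le> F x"
  using assms(5-7)
proof (induction "card {i\<in>{..<n}. x i \<noteq> y i}" arbitrary: y rule: less_induct)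
  case less
  show ?case
  proof (cases "\<forall>i<n. x i = y i")
    case True
    then show ?thesis using cong[of y x] by simp
  next
    case False
    have "\<exists>i<n. y i < x i"
    proof (rule ccontr)
      assume "\<not> (\<exists>i<n. y i < x i)"
      then have le: "x i \<le> y i" if "i < n" for i
        using that by force
      moreover obtain i where "i < n" "x i \<noteq> y i"
        using False by blast
      ultimately have "x i < y i" by (simp add: order.strict_iff_order)
      then have "(\<Sum>i<n. x i) < (\<Sum>i<n. y i)"
        using le \<open>i < n\<close> by (intro sum_strict_mono_ex1) auto
      then show False using less.prems(3) by simp
    qed
    define k where "k = (LEAST i. i < n \<and> y i < x i)"
    have k: "k < n" "y k < x k"
      using LeastI_ex[of "\<lambda>i. i < n \<and> y i < x i"] \<open>\<exists>i<n. y i < x i\<close> by (auto simp: k_def)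
    have before: "x i \<le> y i" if "i < k" for i
      using not_less_Least[of i "\<lambda>i. i < n \<and> y i < x i"] that k(1) by (auto simp: k_def)
    have "\<exists>j<k. x j < y j"
    proof (rule ccontr)
      assume "\<not> (\<exists>j<k. x j < y j)"
      then have "y i \<le> x i" if "i < k" for i
        using that by force
      then have "(\<Sum>i<Suc k. y i) < (\<Sum>i<Suc k. x i)"
        using k by (intro sum_strict_mono_ex1) (auto simp: less_Suc_eq)
      then show False using less.prems(2)[of "Suc k"] k by simp
    qed
    then obtain j where j: "j < k" "x j < y j" by blast
    define d where "d = min (y j - x j) (x k - y k)"
    define z where "z = y(j := y j - d, k := y k + d)"
    have d: "0 < d" "d \<le> y j - x j" "d \<le> x k - y k"
      using j k by (auto simp: d_def)
    have xjk: "x k \<le> x j" using decreasing[of j k] j k by simp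
    have zi: "z i = y i + (if i = k then d else 0) - (if i = j then d else 0)" for i
      using j by (auto simp: z_def)
    have sum_z: "(\<Sum>i<m. z i) = (\<Sum>i<m. y i) + (if k < m then d else 0) - (if j < m then d else 0)" for m
      by (simp add: zi sum.distrib sum_subtractf)
    have "F y \<le> F z"
      unfolding z_def using j k d xjk less.prems(1) by (intro step) auto
    also have "F z \<le> F x"
    proof (rule less.hyps)
      obtain l where l: "l \<in> {j, k}" "z l = x l"
      proof (cases "y j - x j \<le> x k - y k")
        case True
        then show ?thesis using that[of j] j by (simp add: z_def d_def)
      next
        case False
        then show ?thesis using that[of k] by (simp add: z_def d_def)
      qed
      have "x i \<noteq> y i" if "x i \<noteq> z i" for i
        using that j k by (cases "i = j \<or> i = k") (auto simp: z_def)
      then have sub: "{i\<in>{..<n}. x i \<noteq> z i} \<subseteq> {i\<in>{..<n}. x i \<noteq> y i}"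
        by blast
      have "l \<in> {i\<in>{..<n}. x i \<noteq> y i}" "l \<notin> {i\<in>{..<n}. x i \<noteq> z i}"
        using l j k by auto
      with sub have "{i\<in>{..<n}. x i \<noteq> z i} \<subset> {i\<in>{..<n}. x i \<noteq> y i}"
        by (metis psubsetI)
      then show "card {i\<in>{..<n}. x i \<noteq> z i} < card {i\<in>{..<n}. x i \<noteq> y i}"
        by (intro psubset_card_mono) auto
      show "0 \<le> z i" if "i < n" for i
        using less.prems(1)[OF that] d x[OF that] j k by (auto simp: z_def)
      show "(\<Sum>i<m. x i) \<le> (\<Sum>i<m. z i)" if "m \<le> n" for m
      proof (cases "j < m \<and> m \<le> k")
        case True
        have "y j - x j \<le> (\<Sum>i<m. y i - x i)"
          using True before by (intro member_le_sum) auto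
        then show ?thesis using True d by (simp add: sum_z sum_subtractf)
      next
        case False
        then show ?thesis using less.prems(2)[OF that] j by (auto simp: sum_z)
      qed
      show "(\<Sum>i<n. x i) = (\<Sum>i<n. z i)"
        using less.prems(3) j k by (simp add: sum_z)
    qed
    finally show ?thesis .
  qed
qed

section \<open>Schur concavity of the moments\<close>

lemma mset_decreasing_rearrangement [simp]:
  "mset (decreasing_rearrangement x) = mset x"
  by (simp add: decreasing_rearrangement_def)

lemma length_decreasing_rearrangement [simp]:
  "length (decreasing_rearrangement x) = length x"
  by (simp add: decreasing_rearrangement_def)

lemma decreasing_rearrangement_nth_mono:
  assumes "i \<le> j" "j < length x"
  shows "decreasing_rearrangement x ! j \<le> decreasing_rearrangement x ! i"
  using assms unfolding decreasing_rearrangement_def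
  by (simp add: rev_nth) (rule sorted_nth_mono, auto)

lemma prod_nth_decreasing_rearrangement:
  fixes f :: "real \<Rightarrow> 'b::comm_monoid_mult"
  shows "(\<Prod>i<length x. f (decreasing_rearrangement x ! i)) = (\<Prod>i<length x. f (x ! i))"
proof -
  have list: "(\<Prod>i<length u. f (u ! i)) = prod_mset (image_mset f (mset u))" for u
  proof -
    have "prod_mset (image_mset f (mset u)) = prod_list (map f u)"
      by (simp only: prod_mset_prod_list flip: mset_map)
    then show ?thesis by (simp add: prod.list_conv_set_nth atLeast0LessThan)
  qed
  show ?thesis using list[of x] list[of "decreasing_rearrangement x"] by simp
qed

lemma sum_nth_decreasing_rearrangement:
  "(\<Sum>i<length x. decreasing_rearrangement x ! i) = (\<Sum>i<length x. x ! i)"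
proof -
  have list: "(\<Sum>i<length u. u ! i) = sum_mset (mset u)" for u :: "real list"
    by (simp add: sum_mset_sum_list sum_list_sum_nth atLeast0LessThan)
  show ?thesis using list[of x] list[of "decreasing_rearrangement x"] by simp
qed

lemma decreasing_rearrangement_nth_nonneg:
  assumes "x \<in> nonneg_orthant n" "i < n"
  shows "0 \<le> decreasing_rearrangement x ! i"
proof -
  have "set (decreasing_rearrangement x) = set x"
    by (simp add: decreasing_rearrangement_def)
  then have "decreasing_rearrangement x ! i \<in> set x"
    using assms nth_mem[of i "decreasing_rearrangement x"] by (simp add: nonneg_orthant_def)
  then show ?thesis
    using assms by (auto simp: nonneg_orthant_def in_set_conv_nth)
qed

theorem theorem4p1:
  fixes M :: "'a measure" and X :: "nat \<Rightarrow> 'a \<Rightarrow> real" and k n :: nat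
  assumes "prob_space M"
    and "prob_space.indep_vars M (\<lambda>_. borel) X UNIV"
    and "\<And>j. distributed M lborel (X j) (exponential_density 1)"
    and "1 \<le> k" and "k \<le> 4"
  shows "schur_concave_on (nonneg_orthant n)
    (\<lambda>x. prob_space.expectation M (\<lambda>\<omega>. (\<Sum>j<n. sqrt (x ! j) * X j \<omega>) ^ k))"
  unfolding schur_concave_on_def
proof (intro ballI impI)
  interpret prob_space M by fact
  define F where "F z = fps_nth (\<Prod>l<n. geometric_fps (sqrt (z l))) k" for z :: "nat \<Rightarrow> real"
  have "indep_vars (\<lambda>_. borel) X {..<n}"
    using assms(2) by (rule indep_vars_subset) auto
  then have moment: "expectation (\<lambda>\<omega>. (\<Sum>j<n. sqrt (z ! j) * X j \<omega>) ^ k) = fact k * F (nth z)" for z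
    using expectation_power_weighted_sum[of "{..<n}" X "\<lambda>j. sqrt (z ! j)" k] assms(3)
    by (simp add: F_def)
  fix x y
  assume x: "x \<in> nonneg_orthant n" and y: "y \<in> nonneg_orthant n" and "majorized x y"
  let ?x = "decreasing_rearrangement x" and ?y = "decreasing_rearrangement y"
  have len: "length x = n" "length y = n"
    using x y by (auto simp: nonneg_orthant_def)
  have rearrange: "F (nth (decreasing_rearrangement z)) = F (nth z)" if "length z = n" for z
    using prod_nth_decreasing_rearrangement[of "\<lambda>t. geometric_fps (sqrt t)" z] that
    by (simp add: F_def)
  have total: "(\<Sum>i<n. ?x ! i) = (\<Sum>i<n. ?y ! i)"
    using \<open>majorized x y\<close> sum_nth_decreasing_rearrangement[of x] sum_nth_decreasing_rearrangement[of y] len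
    by (simp add: majorized_def)
  have partial: "(\<Sum>i<m. ?x ! i) \<le> (\<Sum>i<m. ?y ! i)" if "m \<le> n" for m
    using \<open>majorized x y\<close> that len by (cases "m = 0") (auto simp: majorized_def)
  have "F (nth ?y) \<le> F (nth ?x)"
  proof (rule transfer_monotone_majorization[of n F])
    show "F z \<le> F (z(i := z i - d, j := z j + d))"
      if "i < n" "j < n" "i \<noteq> j" "\<And>l. l < n \<Longrightarrow> 0 \<le> z l" "0 \<le> d" "z j + d \<le> z i - d" for z i j d
      unfolding F_def using that \<open>k \<le> 4\<close> by (rule complete_homogeneous_sqrt_transfer)
    show "F z = F w" if "\<And>i. i < n \<Longrightarrow> z i = w i" for z w
      unfolding F_def using that by simp
  qed (use total partial x y len in
      \<open>auto intro: decreasing_rearrangement_nth_nonneg decreasing_rearrangement_nth_mono\<close>)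
  then have "F (nth y) \<le> F (nth x)"
    by (simp add: rearrange len)
  then show "expectation (\<lambda>\<omega>. (\<Sum>j<n. sqrt (y ! j) * X j \<omega>) ^ k)
      \<le> expectation (\<lambda>\<omega>. (\<Sum>j<n. sqrt (x ! j) * X j \<omega>) ^ k)"
    by (simp add: moment)
qed

end
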